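(* Let $n \ge 1$ and let $\alpha, \beta, \gamma, \theta \in \mathbb{F}_{3^n}^*$. Define $f: \mathbb{F}_{3^n} \to \mathbb{F}_{3^n}$ by $$f(x) = \begin{cases} 0 & \text{if } x = 0, \\ \alpha(x^3 + \gamma x^2 + \gamma^2 x) & \text{if } x \in C_0, \\ \beta(x^3 + \theta x^2 + \theta^2 x) & \text{if } x \in C_1. \end{cases}$$ Suppose $f$ is a permutation of $\mathbb{F}_{3^n}$ and $\eta(\alpha) = (-1)^m$ with $m \in \{0,1\}$. Then the inverse of $f$ on $\mathbb{F}_{3^n}$ is $$f^{-1}(x) = -u(x)\left(1 + (-1)^m x^{(3^n-1)/2}\right) - v(x)\left(1 + (-1)^{m+1} x^{(3^n-1)/2}\right),$$ where $$u(x) = \sum_{0 \le j,k \le n-1} \gamma \left(\alpha^{-1}\gamma^{-3} x\right)^{\frac{3^j+3^k}{2}}, \qquad v(x) = \sum_{0 \le j,k \le n-1} \theta \left(\beta^{-1}\theta^{-3} x\right)^{\frac{3^j+3^k}{2}}.$$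
   Context: $C_0 = \{e^2 : e \in \mathbb{F}_{3^n}^*\}$ is the set of nonzero squares and $C_1 = \mathbb{F}_{3^n}^* \setminus C_0$. $\eta$ denotes the quadratic character of $\mathbb{F}_{3^n}$: $\eta(a) = 1$ if $a \in C_0$ and $\eta(a) = -1$ if $a \in C_1$. The inverse of $f$ is a polynomial $g \in \mathbb{F}_{3^n}[x]$ with $g(f(c)) = c$ for all $c \in \mathbb{F}_{3^n}$. It is known that such $f$ is a permutation if and only if $\eta(\gamma) = -1$, $\eta(\theta) = 1$ and $\eta(\alpha) = \eta(\beta)$. *)

theory Defs
  imports "HOL-Computational_Algebra.Polynomial"
begin

text \<open>
  The field \<open>\<F>\<close> of order \<open>3 ^ n\<close> is modelled by a type of sort \<open>{finite, field}\<close> whose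
  cardinality is \<open>3 ^ n\<close>.
\<close>

definition nonzero_squares :: "'a::field set" where
  "nonzero_squares = {e ^ 2 | e. e \<noteq> 0}"

definition nonsquares :: "'a::field set" where
  "nonsquares = (UNIV - {0}) - nonzero_squares"

text \<open>The value at \<open>0\<close> is the usual convention for the quadratic character.\<close>

definition quad_char :: "'a::field \<Rightarrow> int" where
  "quad_char a = (if a \<in> nonzero_squares then 1 else if a \<in> nonsquares then - 1 else 0)"

definition piecewise_cubic :: "'a::field \<Rightarrow> 'a \<Rightarrow> 'a \<Rightarrow> 'a \<Rightarrow> 'a \<Rightarrow> 'a" where
  "piecewise_cubic \<alpha> \<beta> \<gamma> \<theta> x =
     (if x = 0 then 0
      else if x \<in> nonzero_squares then \<alpha> * (x ^ 3 + \<gamma> * x ^ 2 + \<gamma> ^ 2 * x)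
      else \<beta> * (x ^ 3 + \<theta> * x ^ 2 + \<theta> ^ 2 * x))"

definition is_inverse_poly :: "('a::field \<Rightarrow> 'a) \<Rightarrow> 'a poly \<Rightarrow> bool" where
  "is_inverse_poly f g \<longleftrightarrow> (\<forall>c. poly g (f c) = c)"

text \<open>
  Both \<open>u\<close> and \<open>v\<close> are instances of the following polynomial, with parameters
  \<open>(\<alpha>, \<gamma>)\<close> and \<open>(\<beta>, \<theta>)\<close>.  The exponents are exact, as \<open>3 ^ j + 3 ^ k\<close> is even.
\<close>

definition branch_poly :: "nat \<Rightarrow> 'a::field \<Rightarrow> 'a \<Rightarrow> 'a poly" where
  "branch_poly n a c =
     (\<Sum>j<n. \<Sum>k<n. smult c ((smult (inverse a * inverse (c ^ 3)) (monom 1 1)) ^ ((3 ^ j + 3 ^ k) div 2)))"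

end

theory Submission
  imports Defs
begin

text \<open>
  In characteristic 3 the branches are \<open>a x (x - c)\<^sup>2\<close>.  A permutation forces \<open>\<gamma>\<close>
  to be a nonsquare and \<open>\<theta>\<close> a square (otherwise a nonzero point is sent to \<open>0\<close>), and
  \<open>\<alpha>\<close>, \<open>\<beta>\<close> to have the same character (otherwise only one square class is hit).  Hence
  for \<open>y = f x\<close> the two factors in the inverse are \<open>2\<close> and \<open>0\<close>, selecting the branch
  of \<open>x\<close>, and in both branches \<open>z = x / c\<close> is a nonsquare.  If \<open>t\<^sup>2 = z\<close> in an extension, the double
  sum is \<open>c (\<Sum>j. (t\<^sup>3 - t) ^ 3 ^ j)\<^sup>2 = c (t ^ q - t)\<^sup>2 = c (- 2 t)\<^sup>2 = c z = x\<close>,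
  with \<open>q = 3 ^ n\<close>.  Only even powers of \<open>t\<close> occur, so the extension is not needed.
\<close>

section \<open>Euler's criterion in a finite field of odd order\<close>

lemma finite_field_fermat:
  fixes x :: "'a::{finite, field}"
  assumes "x \<noteq> 0"
  shows "x ^ (card (UNIV :: 'a set) - 1) = 1"
proof -
  let ?U = "UNIV - {0 :: 'a}"
  have "(\<Prod>y\<in>?U. y) = (\<Prod>y\<in>?U. x * y)"
    by (rule prod.reindex_bij_witness[of _ "\<lambda>y. x * y" "\<lambda>y. y / x"]) (use assms in auto)
  also have "\<dots> = x ^ card ?U * (\<Prod>y\<in>?U. y)"
    by (simp add: prod.distrib)
  finally show ?thesis
    by (simp add: card_Diff_singleton)
qed

lemma card_sqrt_le: "card {e :: 'a::{finite, field}. e ^ 2 = s} \<le> 2"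
proof (cases "\<exists>r. r ^ 2 = s")
  case True
  then obtain r where "r ^ 2 = s" ..
  then have "{e. e ^ 2 = s} \<subseteq> {r, - r}"
    by (auto simp: power2_eq_iff)
  then have "card {e. e ^ 2 = s} \<le> card {r, - r}"
    by (intro card_mono) auto
  also have "\<dots> \<le> 2"
    by (simp add: card_insert_if)
  finally show ?thesis .
qed auto

text \<open>The fibres of squaring cover the nonzero elements, and each has at most two members. The
  bound supplies enough roots for the counting argument in
  \<open>nonsquare_power_half\<close>.\<close>

lemma card_nonzero_squares_ge:
  "(card (UNIV :: 'a::{finite, field} set) - 1) div 2 \<le> card (nonzero_squares :: 'a set)"
proof -
  let ?U = "UNIV - {0 :: 'a}" and ?S = "nonzero_squares :: 'a set"
  have "?U \<subseteq> (\<Union>s\<in>?S. {e. e ^ 2 = s})"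
    by (auto simp: nonzero_squares_def)
  then have "card ?U \<le> card (\<Union>s\<in>?S. {e. e ^ 2 = s})"
    by (intro card_mono) auto
  also have "\<dots> \<le> (\<Sum>s\<in>?S. card {e. e ^ 2 = s})"
    by (intro card_UN_le) simp
  also have "\<dots> \<le> (\<Sum>s\<in>?S. 2)"
    by (intro sum_mono card_sqrt_le)
  finally show ?thesis
    by (simp add: card_Diff_singleton)
qed

lemma square_power_half:
  fixes x :: "'a::{finite, field}"
  assumes "odd (card (UNIV :: 'a set))" "x \<in> nonzero_squares"
  shows "x ^ ((card (UNIV :: 'a set) - 1) div 2) = 1"
  using assms finite_field_fermat[where 'a = 'a]
  by (auto simp: nonzero_squares_def simp flip: power_mult)

text \<open>The squares already provide \<open>h\<close> roots of \<open>X^h - 1\<close>, as many as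
  its degree allows, so \<open>x ^ h\<close> cannot be 1. It squares to 1 by Fermat, which leaves
  -1.\<close>

lemma nonsquare_power_half:
  fixes x :: "'a::{finite, field}"
  assumes "odd (card (UNIV :: 'a set))" "x \<noteq> 0" "x \<notin> nonzero_squares"
  shows "x ^ ((card (UNIV :: 'a set) - 1) div 2) = - 1"
proof -
  define h where "h = (card (UNIV :: 'a set) - 1) div 2"
  have "card {0, 1 :: 'a} \<le> card (UNIV :: 'a set)"
    by (intro card_mono) auto
  then have "card (UNIV :: 'a set) \<ge> 2"
    by simp
  with assms(1) have "card (UNIV :: 'a set) \<ge> 3"
    by (cases "card (UNIV :: 'a set) = 2") auto
  then have "h > 0"
    unfolding h_def by linarith
  with assms(1) have h: "h > 0" "card (UNIV :: 'a set) - 1 = h * 2"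
    by (auto simp: h_def)
  define p :: "'a poly" where "p = monom 1 h - 1"
  have deg: "degree p \<le> h"
    unfolding p_def by (intro degree_diff_le) (auto simp: degree_monom_eq)
  \<comment> \<open>Positivity of \<open>h\<close> matters: for \<open>h = 0\<close> the polynomial
    would be 1 - 1 = 0.\<close>
  have "coeff p h = 1"
    using h(1) by (simp add: p_def coeff_1)
  then have "p \<noteq> 0"
    by auto
  have "x ^ h \<noteq> 1"
  proof
    assume "x ^ h = 1"
    then have "insert x nonzero_squares \<subseteq> {y. poly p y = 0}"
      using square_power_half[OF assms(1)] by (auto simp: p_def h_def poly_monom)
    then have "card (insert x nonzero_squares) \<le> card {y. poly p y = 0}"
      by (intro card_mono) auto
    also have "\<dots> \<le> h"
      using card_poly_roots_bound[OF \<open>p \<noteq> 0\<close>] deg by linarith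
    finally show False
      using card_nonzero_squares_ge[where 'a = 'a] assms(3) by (simp add: h_def)
  qed
  moreover have "(x ^ h) ^ 2 = 1"
    using finite_field_fermat[OF assms(2)] h(2) by (simp add: power_mult)
  ultimately show ?thesis
    by (simp add: power2_eq_1_iff h_def)
qed

section \<open>Identities in characteristic 3\<close>

lemma card_power3_three_eq_0:
  assumes "card (UNIV :: 'a::{finite, field} set) = 3 ^ n"
  shows "(3 :: 'a) = 0"
proof -
  \<comment> \<open>Translation by 1 permutes the field, so the total of the added ones, the order
    of the field, vanishes in it.\<close>
  have "(\<Sum>y\<in>UNIV. y + 1) = (\<Sum>y\<in>UNIV. y :: 'a)"
    by (rule sum.reindex_bij_witness[of _ "\<lambda>y. y - 1" "\<lambda>y. y + 1"]) auto
  then have "of_nat (3 ^ n) = (0 :: 'a)"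
    by (simp add: sum.distrib assms)
  then show ?thesis
    by simp
qed

lemma char3_diff_power:
  fixes x y :: "'a::comm_ring_1"
  assumes "(3 :: 'a) = 0"
  shows "(x - y) ^ 3 ^ k = x ^ 3 ^ k - y ^ 3 ^ k"
proof (induction k)
  case (Suc k)
  have cube: "(a - b) ^ 3 = a ^ 3 - b ^ 3" for a b :: 'a
  proof -
    have "(a - b) ^ 3 = a ^ 3 - b ^ 3 - 3 * (a ^ 2 * b - a * b ^ 2)"
      by (simp add: algebra_simps power2_eq_square power3_eq_cube)
    then show ?thesis
      using assms by simp
  qed
  show ?case
    by (simp add: power_mult mult.commute[of 3] Suc cube)
qed simp

text \<open>Here \<open>c = -2 * c\<close>. The factored form exposes the double root at
  \<open>c\<close> and shows that elsewhere the quadratic character of the value is that of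
  \<open>x\<close>.\<close>

lemma char3_cubic_factor:
  fixes x c :: "'a::comm_ring_1"
  assumes "(3 :: 'a) = 0"
  shows "x ^ 3 + c * x ^ 2 + c ^ 2 * x = x * (x - c) ^ 2"
proof -
  have "x ^ 3 + c * x ^ 2 + c ^ 2 * x = x * (x - c) ^ 2 + 3 * (c * x ^ 2)"
    by (simp add: algebra_simps power2_eq_square power3_eq_cube)
  then show ?thesis
    using assms by simp
qed

text \<open>The summand is a mixed second difference; telescoping in both indices leaves the four
  corners.\<close>

lemma double_sum_telescope:
  fixes a :: "nat \<Rightarrow> nat \<Rightarrow> 'a::ab_group_add"
  shows "(\<Sum>j<n. \<Sum>k<n. a (Suc j) (Suc k) - a (Suc j) k - a j (Suc k) + a j k)
    = a n n - a n 0 - a 0 n + a 0 0"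
proof -
  have "(\<Sum>k<n. a (Suc j) (Suc k) - a (Suc j) k - a j (Suc k) + a j k)
      = (a (Suc j) n - a (Suc j) 0) - (a j n - a j 0)" for j
  proof -
    have "(\<Sum>k<n. a (Suc j) (Suc k) - a (Suc j) k - a j (Suc k) + a j k)
        = (\<Sum>k<n. (a (Suc j) (Suc k) - a j (Suc k)) - (a (Suc j) k - a j k))"
      by (intro sum.cong) (auto simp: algebra_simps)
    then show ?thesis
      by (simp only: sum_lessThan_telescope[where f = "\<lambda>k. a (Suc j) k - a j k"])
        (simp add: algebra_simps)
  qed
  then show ?thesis
    by (simp only: sum_lessThan_telescope[where f = "\<lambda>j. a j n - a j 0"]) (simp add: algebra_simps)
qed

lemma char3_half_power_sum:
  fixes z :: "'a::comm_ring_1"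
  assumes "(3 :: 'a) = 0"
  shows "(\<Sum>j<n. \<Sum>k<n. (z * (z - 1) ^ 2) ^ ((3 ^ j + 3 ^ k) div 2))
    = z ^ 3 ^ n - 2 * z ^ ((3 ^ n + 1) div 2) + z"
proof -
  \<comment> \<open>\<open>a j k\<close> plays the role of \<open>t^(3^j + 3^k)\<close> with
    \<open>t^2 = z\<close>. Multiplying by \<open>z^(3^j) = t^(2 * 3^j)\<close> raises
    \<open>j\<close> by one, since \<open>3^j + 2 * 3^j = 3^(j+1)\<close>.\<close>
  define a where "a j k = z ^ ((3 ^ j + 3 ^ k) div 2)" for j k :: nat
  have shift1: "a j k * z ^ 3 ^ j = a (Suc j) k" for j k
  proof -
    have "(3 ^ j + 3 ^ k) div 2 + 3 ^ j = (3 ^ Suc j + 3 ^ k) div (2 :: nat)"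
      by simp
    then show ?thesis
      by (simp only: a_def flip: power_add)
  qed
  have shift2: "a j k * z ^ 3 ^ k = a j (Suc k)" for j k
    using shift1[of k j] by (simp add: a_def add.commute)
  have "(z * (z - 1) ^ 2) ^ ((3 ^ j + 3 ^ k) div 2)
      = a (Suc j) (Suc k) - a (Suc j) k - a j (Suc k) + a j k" for j k
  proof -
    have "(z * (z - 1) ^ 2) ^ ((3 ^ j + 3 ^ k) div 2) = a j k * (z - 1) ^ (3 ^ j + 3 ^ k)"
      by (simp add: power_mult_distrib a_def flip: power_mult)
    also have "\<dots> = a j k * (z ^ 3 ^ j - 1) * (z ^ 3 ^ k - 1)"
      by (simp add: power_add char3_diff_power[OF assms] mult.assoc)
    also have "\<dots> = a j k * z ^ 3 ^ j * z ^ 3 ^ k - a j k * z ^ 3 ^ j - a j k * z ^ 3 ^ k + a j k"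
      by (simp add: algebra_simps)
    also have "\<dots> = a (Suc j) (Suc k) - a (Suc j) k - a j (Suc k) + a j k"
      by (simp only: shift1 shift2)
    finally show ?thesis .
  qed
  then have "(\<Sum>j<n. \<Sum>k<n. (z * (z - 1) ^ 2) ^ ((3 ^ j + 3 ^ k) div 2))
      = a n n - a n 0 - a 0 n + a 0 0"
    by (simp only: double_sum_telescope)
  then show ?thesis
    by (simp add: a_def add.commute)
qed

section \<open>Inversion of a single branch\<close>

lemma poly_branch_poly:
  "poly (branch_poly n a c) y =
     c * (\<Sum>j<n. \<Sum>k<n. (inverse a * inverse (c ^ 3) * y) ^ ((3 ^ j + 3 ^ k) div 2))"
  by (simp add: branch_poly_def poly_sum poly_monom sum_distrib_left)

lemma poly_branch_poly_0: "poly (branch_poly n a c) 0 = 0"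
proof -
  have "(3 ^ j + 3 ^ k) div 2 > (0 :: nat)" for j k :: nat
    using one_le_power[of "3 :: nat" j] one_le_power[of "3 :: nat" k] by linarith
  then show ?thesis
    by (simp add: poly_branch_poly zero_power)
qed

text \<open>The scaling by the inverses of \<open>a\<close> and \<open>c ^ 3\<close> turns the
  argument into \<open>z * (z - 1) ^ 2\<close> with \<open>z = x / c\<close>. In the closed form of
  the double sum the outer terms are both \<open>z\<close>, and the hypothesis \<open>nonsq\<close>
  makes the middle one \<open>2 * z\<close>; the total is 4z = z.\<close>

lemma poly_branch_poly_inverts:
  fixes a c x :: "'a::{finite, field}"
  assumes card: "card (UNIV :: 'a set) = 3 ^ n"
    and "a \<noteq> 0" "c \<noteq> 0" "x \<noteq> 0"
    and nonsq: "(x / c) ^ ((3 ^ n - 1) div 2) = - 1"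
  shows "poly (branch_poly n a c) (a * (x * (x - c) ^ 2)) = x"
proof -
  have char3: "(3 :: 'a) = 0"
    by (rule card_power3_three_eq_0[OF card])
  define z where "z = x / c"
  have z: "z \<noteq> 0" "x = c * z"
    using assms by (auto simp: z_def)
  have "inverse a * inverse (c ^ 3) * (a * (x * (x - c) ^ 2)) = z * (z - 1) ^ 2"
    using assms by (simp add: z(2) field_simps power2_eq_square power3_eq_cube)
  then have "poly (branch_poly n a c) (a * (x * (x - c) ^ 2))
      = c * (z ^ 3 ^ n - 2 * z ^ ((3 ^ n + 1) div 2) + z)"
    by (simp add: poly_branch_poly char3_half_power_sum[OF char3])
  also have "z ^ 3 ^ n = z"
    using finite_field_fermat[OF z(1)] power_minus_mult[of "3 ^ n" z] by (simp add: card)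
  also have "(3 ^ n + 1) div 2 = Suc ((3 ^ n - 1) div 2)"
    by (cases "(3 :: nat) ^ n") auto
  then have "z ^ ((3 ^ n + 1) div 2) = - z"
    using nonsq by (simp add: z_def)
  also have "z - 2 * - z + z = z + 3 * z"
    by (simp add: algebra_simps)
  finally show ?thesis
    using z(2) char3 by simp
qed

section \<open>Selection of the branch for a permutation\<close>

theorem theorem7:
  fixes \<alpha> \<beta> \<gamma> \<theta> :: "'a::{finite, field}"
    and n m :: nat
  assumes "n \<ge> 1"
    and "card (UNIV :: 'a set) = 3 ^ n"
    and "\<alpha> \<noteq> 0" "\<beta> \<noteq> 0" "\<gamma> \<noteq> 0" "\<theta> \<noteq> 0"
    and "bij (piecewise_cubic \<alpha> \<beta> \<gamma> \<theta>)"
    and "m \<in> {0, 1}"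
    and "quad_char \<alpha> = (- 1) ^ m"
  shows "is_inverse_poly (piecewise_cubic \<alpha> \<beta> \<gamma> \<theta>)
           (- branch_poly n \<alpha> \<gamma> * (1 + (- 1) ^ m * monom 1 ((3 ^ n - 1) div 2))
            - branch_poly n \<beta> \<theta> * (1 + (- 1) ^ (m + 1) * monom 1 ((3 ^ n - 1) div 2)))"
proof -
  define h :: nat where "h = (3 ^ n - 1) div 2"
  define f where "f = piecewise_cubic \<alpha> \<beta> \<gamma> \<theta>"
  define S where "S = (nonzero_squares :: 'a set)"
  define s where "s = ((- 1) ^ m :: 'a)"
  have char3: "(3 :: 'a) = 0"
    by (rule card_power3_three_eq_0[OF assms(2)])
  have two: "(2 :: 'a) = - 1"
    using char3 by (simp add: eq_neg_iff_add_eq_0)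
  have odd: "odd (card (UNIV :: 'a set))"
    by (simp add: assms(2))
  have sq: "x ^ h = 1" if "x \<in> S" for x
    using square_power_half[OF odd] that by (simp add: S_def h_def assms(2))
  have nsq: "x ^ h = - 1" if "x \<noteq> 0" "x \<notin> S" for x
    using nonsquare_power_half[OF odd] that by (simp add: S_def h_def assms(2))
  have nz: "x \<noteq> 0" if "x \<in> S" for x
    using that by (auto simp: S_def nonzero_squares_def)
  have f0: "f 0 = 0"
    by (simp add: f_def piecewise_cubic_def)
  have fsq: "f x = \<alpha> * (x * (x - \<gamma>) ^ 2)" if "x \<in> S" for x
    using that nz[OF that]
    by (simp add: f_def S_def piecewise_cubic_def char3_cubic_factor[OF char3])
  have fnsq: "f x = \<beta> * (x * (x - \<theta>) ^ 2)" if "x \<noteq> 0" "x \<notin> S" for x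
    using that by (simp add: f_def S_def piecewise_cubic_def char3_cubic_factor[OF char3])
  have inj: "f x = f y \<longleftrightarrow> x = y" for x y
    using assms(7) by (simp add: f_def bij_def inj_eq)
  have \<gamma>: "\<gamma> \<notin> S"
    using inj[of \<gamma> 0] fsq[of \<gamma>] f0 assms(5) by auto
  have \<theta>: "\<theta> \<in> S"
    using inj[of \<theta> 0] fnsq[of \<theta>] f0 assms(6) by auto
  have square_h: "((d :: 'a) ^ 2) ^ h = 1" if "d \<noteq> 0" for d
    using that by (intro sq) (auto simp: S_def nonzero_squares_def)
  have fsq_h: "f x ^ h = \<alpha> ^ h" if "x \<in> S" for x
  proof -
    have "x \<noteq> \<gamma>"
      using that \<gamma> by auto
    then show ?thesis
      using square_h[of "x - \<gamma>"] sq[OF that] by (simp add: fsq[OF that] power_mult_distrib)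
  qed
  have fnsq_h: "f x ^ h = - (\<beta> ^ h)" if "x \<noteq> 0" "x \<notin> S" for x
  proof -
    have "x \<noteq> \<theta>"
      using that \<theta> by auto
    then show ?thesis
      using square_h[of "x - \<theta>"] nsq[OF that] by (simp add: fnsq[OF that] power_mult_distrib)
  qed
  have "\<alpha> ^ h = \<beta> ^ h"
  proof (rule ccontr)
    assume ne: "\<alpha> ^ h \<noteq> \<beta> ^ h"
    then have "\<alpha> ^ h = - (\<beta> ^ h)"
      using sq[of \<alpha>] nsq[OF assms(3)] sq[of \<beta>] nsq[OF assms(4)] by fastforce
    then have "f x ^ h = \<alpha> ^ h" if "x \<noteq> 0" for x
      using that fsq_h[of x] fnsq_h[of x] by metis
    \<comment> \<open>If the characters differed, every nonzero point would have its value in the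
      class of \<alpha>, while \<beta> lies in the other class and still needs a preimage, which is
      nonzero because \<open>f 0 = 0\<close>.\<close>
    moreover obtain x where "f x = \<beta>"
      using assms(7) by (metis bij_pointE f_def)
    ultimately show False
      using ne f0 assms(4) by metis
  qed
  \<comment> \<open>Euler's criterion carries the integer sign \<open>quad_char \<alpha>\<close>
    over to the field element \<open>s\<close>.\<close>
  moreover have "\<alpha> ^ h = s"
  proof (cases "\<alpha> \<in> S")
    case True
    then have "m = 0"
      using assms(8,9) by (auto simp: quad_char_def S_def)
    then show ?thesis
      using sq[OF True] by (simp add: s_def)
  next
    case False
    then have "m = 1"
      using assms(3,8,9) by (auto simp: quad_char_def nonsquares_def S_def)
    then show ?thesis
      using nsq[OF assms(3) False] by (simp add: s_def)
  qed
  ultimately have \<alpha>\<beta>: "\<alpha> ^ h = s" "\<beta> ^ h = s"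
    by auto
  have ss: "s * s = 1"
    by (simp add: s_def flip: power_add mult_2)
  let ?u = "branch_poly n \<alpha> \<gamma>" and ?v = "branch_poly n \<beta> \<theta>"
  \<comment> \<open>The product \<open>s * f x ^ h\<close> is 1 on squares and -1 on nonsquares, so
    one factor vanishes and the other is 2 = -1, which cancels the leading minus sign.\<close>
  have "- poly ?u (f x) * (1 + s * f x ^ h) - poly ?v (f x) * (1 - s * f x ^ h) = x" for x
  proof -
    consider "x = 0" | "x \<in> S" | "x \<noteq> 0" "x \<notin> S"
      by blast
    then show ?thesis
    proof cases
      case 1
      then show ?thesis
        by (simp add: f0 poly_branch_poly_0)
    next
      case 2
      have "(x / \<gamma>) ^ h = - 1"
        using sq[OF 2] nsq[OF assms(5) \<gamma>] by (simp add: power_divide)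
      then have "poly ?u (f x) = x"
        using poly_branch_poly_inverts[OF assms(2,3,5) nz[OF 2]] by (simp add: fsq[OF 2] h_def)
      then show ?thesis
        using fsq_h[OF 2] by (simp add: \<alpha>\<beta> ss two)
    next
      case 3
      have "(x / \<theta>) ^ h = - 1"
        using nsq[OF 3] sq[OF \<theta>] by (simp add: power_divide)
      then have "poly ?v (f x) = x"
        using poly_branch_poly_inverts[OF assms(2,4,6) 3(1)] by (simp add: fnsq[OF 3] h_def)
      then show ?thesis
        using fnsq_h[OF 3] by (simp add: \<alpha>\<beta> ss two)
    qed
  qed
  then show ?thesis
    by (simp add: is_inverse_poly_def poly_monom poly_power s_def f_def h_def)
qed

end
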